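(* Let $C_n$ be the cycle on $n\ge 3$ vertices. Then $\iota(\mathrm{Mid}(C_n))=\lfloor \frac{n+2}{3}\rfloor$.
   Context: For a graph $H$ and $S\subseteq V(H)$, let $N_H[S]$ be $S$ together with all vertices adjacent to a vertex of $S$. A set $S\subseteq V(H)$ is an isolating set of $H$ if $V(H)\setminus N_H[S]$ is an independent set of $H$; $\iota(H)$ is the minimum size of an isolating set of $H$. The middle graph $\mathrm{Mid}(G)$ has vertex set $V(G)\cup\{m_e: e\in E(G)\}$, with $v\sim m_e$ iff $v$ is an endpoint of $e$, $m_e\sim m_f$ iff distinct edges $e,f$ share an endpoint, and no edges between vertices of $V(G)$. *)

theory Defs
  imports Main
begin

text \<open>A graph is a pair of a vertex set and a set of edges, each edge being the two-element set of
  its endpoints.\<close>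

type_synonym 'a graph = "'a set \<times> 'a set set"

abbreviation verts :: "'a graph \<Rightarrow> 'a set" where
  "verts G \<equiv> fst G"

abbreviation edges :: "'a graph \<Rightarrow> 'a set set" where
  "edges G \<equiv> snd G"

definition simple_graph :: "'a graph \<Rightarrow> bool" where
  "simple_graph G \<longleftrightarrow> (\<forall>e\<in>edges G. e \<subseteq> verts G \<and> card e = 2)"

definition adj :: "'a graph \<Rightarrow> 'a \<Rightarrow> 'a \<Rightarrow> bool" where
  "adj G u v \<longleftrightarrow> {u, v} \<in> edges G"

definition closed_nbhd :: "'a graph \<Rightarrow> 'a set \<Rightarrow> 'a set" where
  "closed_nbhd H S = S \<union> {v \<in> verts H. \<exists>u\<in>S. adj H u v}"

definition independent_set :: "'a graph \<Rightarrow> 'a set \<Rightarrow> bool" where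
  "independent_set H I \<longleftrightarrow> I \<subseteq> verts H \<and> (\<forall>u\<in>I. \<forall>v\<in>I. \<not> adj H u v)"

definition isolating_set :: "'a graph \<Rightarrow> 'a set \<Rightarrow> bool" where
  "isolating_set H S \<longleftrightarrow> S \<subseteq> verts H \<and> independent_set H (verts H - closed_nbhd H S)"

text \<open>Finiteness is required because \<open>card\<close> is \<open>0\<close> on infinite sets; it is automatic in a finite
  graph.\<close>

definition isolation_number :: "'a graph \<Rightarrow> nat" where
  "isolation_number H = (LEAST k. \<exists>S. finite S \<and> isolating_set H S \<and> card S = k)"

text \<open>\<open>Inl v\<close> is the original vertex \<open>v\<close> and \<open>Inr e\<close> is the vertex \<open>m\<^sub>e\<close> of the edge \<open>e\<close>.\<close>

definition middle_graph :: "'a graph \<Rightarrow> ('a + 'a set) graph" where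
  "middle_graph G =
    (Inl ` verts G \<union> Inr ` edges G,
     {{Inl v, Inr e} | v e. e \<in> edges G \<and> v \<in> e} \<union>
     {{Inr e, Inr f} | e f. e \<in> edges G \<and> f \<in> edges G \<and> e \<noteq> f \<and> e \<inter> f \<noteq> {}})"

text \<open>For \<open>n \<ge> 3\<close> this is the usual cycle on \<open>n\<close> vertices; smaller \<open>n\<close> are degenerate.\<close>

definition cycle_graph :: "nat \<Rightarrow> nat graph" where
  "cycle_graph n = ({..<n}, {{i, Suc i mod n} | i. i < n})"

lemma simple_graph_cycle_graph:
  assumes "n \<ge> 3"
  shows "simple_graph (cycle_graph n)"
proof -
  have "i \<noteq> Suc i mod n" if "i < n" for i
    using that assms by (cases "Suc i = n") auto
  then show ?thesis
    using assms unfolding simple_graph_def cycle_graph_def by (auto simp: card_insert_if)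
qed

lemma simple_graph_middle_graph:
  assumes "simple_graph G"
  shows "simple_graph (middle_graph G)"
proof -
  have "e \<subseteq> verts G" if "e \<in> edges G" for e
    using assms that by (simp add: simple_graph_def)
  then show ?thesis
    unfolding simple_graph_def middle_graph_def by (auto simp: card_insert_if)
qed

lemma adj_middle_graph:
  "adj (middle_graph G) (Inl u) (Inl v) \<longleftrightarrow> False"
  "adj (middle_graph G) (Inl v) (Inr e) \<longleftrightarrow> e \<in> edges G \<and> v \<in> e"
  "adj (middle_graph G) (Inr e) (Inl v) \<longleftrightarrow> e \<in> edges G \<and> v \<in> e"
  "adj (middle_graph G) (Inr e) (Inr f) \<longleftrightarrow>
    e \<in> edges G \<and> f \<in> edges G \<and> e \<noteq> f \<and> e \<inter> f \<noteq> {}"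
  by (auto simp: adj_def middle_graph_def doubleton_eq_iff)

end

theory Submission
  imports Defs
begin

text \<open>If \<open>m\<^sub>e\<close> is not dominated by an isolating set of the middle graph, then neither is an endpoint
  \<open>v\<close> of \<open>e\<close>, since whatever dominates \<open>v\<close> also dominates \<open>m\<^sub>e\<close>; but \<open>v\<close> and \<open>m\<^sub>e\<close> are adjacent. So
  isolating sets are exactly the sets dominating all \<open>m\<^sub>e\<close>. In a cycle, a vertex of the middle graph
  dominates at most three of the \<open>m\<^sub>e\<close>, and choosing every third edge attains this bound.\<close>

text \<open>The edges \<open>e\<close> whose vertex \<open>Inr e\<close> equals or is adjacent to
  \<open>x\<close>. For \<open>x = Inr f\<close>, the single condition
  \<open>e \<inter> f \<noteq> {}\<close> merges adjacency with the case \<open>e = f\<close>, edges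
  being nonempty.\<close>

definition dominated_edges :: "'a graph \<Rightarrow> 'a + 'a set \<Rightarrow> 'a set set" where
  "dominated_edges G x = {e \<in> edges G. case x of Inl v \<Rightarrow> v \<in> e | Inr f \<Rightarrow> e \<inter> f \<noteq> {}}"

lemma Inr_in_closed_nbhd_iff:
  assumes "simple_graph G" "S \<subseteq> verts (middle_graph G)" "e \<in> edges G"
  shows "Inr e \<in> closed_nbhd (middle_graph G) S \<longleftrightarrow> (\<exists>x\<in>S. e \<in> dominated_edges G x)"
proof
  have ne: "e \<noteq> {}"
    using assms by (auto simp: simple_graph_def)
  have V: "Inr e \<in> verts (middle_graph G)"
    using assms by (auto simp: middle_graph_def)
  show "\<exists>x\<in>S. e \<in> dominated_edges G x" if nb: "Inr e \<in> closed_nbhd (middle_graph G) S"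
  proof (cases "Inr e \<in> S")
    case True
    then show ?thesis
      using ne assms(3) by (intro bexI[of _ "Inr e"]) (auto simp: dominated_edges_def)
  next
    case False
    then obtain x where "x \<in> S" "adj (middle_graph G) x (Inr e)"
      using nb by (auto simp: closed_nbhd_def)
    then show ?thesis
      by (intro bexI[of _ x]; cases x) (auto simp: dominated_edges_def adj_middle_graph)
  qed
  show "Inr e \<in> closed_nbhd (middle_graph G) S" if dom: "\<exists>x\<in>S. e \<in> dominated_edges G x"
  proof -
    obtain x where x: "x \<in> S" "e \<in> dominated_edges G x"
      using dom by blast
    moreover have "x \<in> Inl ` verts G \<union> Inr ` edges G"
      using x assms(2) by (auto simp: middle_graph_def)
    ultimately have "x = Inr e \<or> adj (middle_graph G) x (Inr e)"
      by (cases x) (auto simp: dominated_edges_def adj_middle_graph)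
    with x V show ?thesis
      by (auto simp: closed_nbhd_def)
  qed
qed

lemma isolating_set_middle_graph_iff:
  assumes G: "simple_graph G"
  shows "isolating_set (middle_graph G) S \<longleftrightarrow>
    S \<subseteq> verts (middle_graph G) \<and> edges G \<subseteq> (\<Union>x\<in>S. dominated_edges G x)"
proof (intro iffI conjI)
  assume iso: "isolating_set (middle_graph G) S"
  then show S: "S \<subseteq> verts (middle_graph G)"
    by (simp add: isolating_set_def)
  show "edges G \<subseteq> (\<Union>x\<in>S. dominated_edges G x)"
  proof (rule subsetI, rule ccontr)
    fix e assume e: "e \<in> edges G" and und: "e \<notin> (\<Union>x\<in>S. dominated_edges G x)"
    have "e \<subseteq> verts G" "e \<noteq> {}"
      using G e by (auto simp: simple_graph_def)
    then obtain v where v: "v \<in> e" "v \<in> verts G"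
      by blast
    have m: "Inr e \<in> verts (middle_graph G) - closed_nbhd (middle_graph G) S"
      using Inr_in_closed_nbhd_iff[OF G S e] e und by (auto simp: middle_graph_def)
    \<comment> \<open>Any vertex of \<open>S\<close> covering \<open>Inl v\<close> would dominate
      \<open>e\<close>: \<open>Inl v\<close> itself since \<open>v \<in> e\<close>, a neighbour
      \<open>Inr f\<close> since \<open>v \<in> e \<inter> f\<close>.\<close>
    have "Inl v \<notin> S"
      using und e v by (force simp: dominated_edges_def)
    moreover have "\<not> adj (middle_graph G) x (Inl v)" if "x \<in> S" for x
      using und e v that by (cases x) (force simp: dominated_edges_def adj_middle_graph)+
    ultimately have "Inl v \<in> verts (middle_graph G) - closed_nbhd (middle_graph G) S"
      using v by (auto simp: closed_nbhd_def middle_graph_def)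
    moreover have "adj (middle_graph G) (Inl v) (Inr e)"
      using v e by (simp add: adj_middle_graph)
    ultimately show False
      using m iso unfolding isolating_set_def independent_set_def by blast
  qed
next
  assume "S \<subseteq> verts (middle_graph G) \<and> edges G \<subseteq> (\<Union>x\<in>S. dominated_edges G x)"
  then have S: "S \<subseteq> verts (middle_graph G)" and dom: "edges G \<subseteq> (\<Union>x\<in>S. dominated_edges G x)"
    by auto
  \<comment> \<open>Every \<open>Inr e\<close> is covered, so only original vertices can remain, and
    these are pairwise nonadjacent.\<close>
  have "verts (middle_graph G) - closed_nbhd (middle_graph G) S \<subseteq> range Inl" (is "?R \<subseteq> _")
    using Inr_in_closed_nbhd_iff[OF G S] dom by (auto simp: middle_graph_def)
  then have "\<not> adj (middle_graph G) u v" if "u \<in> ?R" "v \<in> ?R" for u v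
    using subsetD[of ?R "range Inl" u] subsetD[of ?R "range Inl" v] that
    by (auto simp: adj_middle_graph(1))
  then have "independent_set (middle_graph G) ?R"
    by (simp add: independent_set_def)
  then show "isolating_set (middle_graph G) S"
    using S by (simp add: isolating_set_def)
qed

text \<open>An upper bound on \<open>card S\<close> suffices, because the lower bound applied to
  \<open>S\<close> itself forces equality. A witness given as an image can thus be bounded by the
  size of its index set.\<close>

lemma isolation_number_eqI:
  assumes "finite S" "isolating_set H S" "card S \<le> k"
    and "\<And>T. finite T \<Longrightarrow> isolating_set H T \<Longrightarrow> k \<le> card T"
  shows "isolation_number H = k"
  unfolding isolation_number_def
  using assms by (intro Least_equality) (auto intro: exI[of _ S] le_antisym)

lemma card_edges_cycle_graph:
  assumes "n \<ge> 3"
  shows "card (edges (cycle_graph n)) = n"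
proof -
  \<comment> \<open>Distinct \<open>i\<close>, \<open>j\<close> with the same edge would each be the
    cyclic successor of the other, so \<open>n\<close> would divide 2.\<close>
  have "inj_on (\<lambda>i. {i, Suc i mod n}) {..<n}"
    using assms by (auto simp: inj_on_def doubleton_eq_iff mod_Suc split: if_splits)
  then have "card ((\<lambda>i. {i, Suc i mod n}) ` {..<n}) = n"
    by (simp add: card_image)
  moreover have "edges (cycle_graph n) = (\<lambda>i. {i, Suc i mod n}) ` {..<n}"
    by (auto simp: cycle_graph_def)
  ultimately show ?thesis by simp
qed

text \<open>An original vertex lies only on the edge starting there and the preceding one; an edge
  meets only itself and its two neighbours along the cycle.\<close>

lemma card_dominated_edges_cycle_graph:
  assumes "x \<in> verts (middle_graph (cycle_graph n))"
  shows "card (dominated_edges (cycle_graph n) x) \<le> 3"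
proof -
  define e where "e i = {i, Suc i mod n}" for i
  \<comment> \<open>The cyclic predecessor, with the wrap at 0 made explicit because
    \<open>0 - 1 = 0\<close> on naturals.\<close>
  define p where "p i = (if i = 0 then n - 1 else i - 1)" for i
  have pred: "j = p i" if "j < n" "Suc j mod n = i" for i j
    using that by (auto simp: p_def mod_Suc split: if_splits)
  have "\<exists>a b c. dominated_edges (cycle_graph n) x \<subseteq> {e a, e b, e c}"
  proof (cases x)
    case (Inl v)
    \<comment> \<open>The repeated \<open>e v\<close> pads two edges to the common triple
      form.\<close>
    have "dominated_edges (cycle_graph n) x \<subseteq> {e v, e (p v), e v}"
      using Inl pred by (auto simp: dominated_edges_def cycle_graph_def e_def)
    then show ?thesis by blast
  next
    case (Inr f)
    with assms obtain i where i: "i < n" "f = {i, Suc i mod n}"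
      by (auto simp: middle_graph_def cycle_graph_def)
    have "j \<in> {i, Suc i mod n, p i}" if "j < n" "{j, Suc j mod n} \<inter> f \<noteq> {}" for j
      using that i pred[of j i] pred[of i "Suc i mod n"] pred[of j "Suc i mod n"] by auto
    then have "dominated_edges (cycle_graph n) x \<subseteq> {e i, e (Suc i mod n), e (p i)}"
      using Inr by (fastforce simp: dominated_edges_def cycle_graph_def e_def)
    then show ?thesis by blast
  qed
  then obtain a b c where "dominated_edges (cycle_graph n) x \<subseteq> {e a, e b, e c}"
    by blast
  then have "card (dominated_edges (cycle_graph n) x) \<le> card {e a, e b, e c}"
    by (intro card_mono) auto
  also have "\<dots> \<le> 3"
    by (simp add: card_insert_if)
  finally show ?thesis .
qed

theorem theorem5:
  fixes n :: nat
  assumes "n \<ge> 3"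
  shows "isolation_number (middle_graph (cycle_graph n)) = (n + 2) div 3"
proof -
  let ?C = "cycle_graph n" and ?k = "(n + 2) div 3"
  note iff = isolating_set_middle_graph_iff[OF simple_graph_cycle_graph[OF assms]]
  define e where "e i = {i, Suc i mod n}" for i
  \<comment> \<open>\<open>?k\<close> is \<open>n / 3\<close> rounded up, so the indices
    \<open>3 * j\<close> with \<open>j < ?k\<close> are exactly the multiples of 3 below
    \<open>n\<close>.\<close>
  define S where "S = (\<lambda>j. Inr (e (3 * j)) :: nat + nat set) ` {..<?k}"
  have edgesC: "edges ?C = e ` {..<n}"
    by (auto simp: cycle_graph_def e_def)
  have "3 * j < n" if "j < ?k" for j
    using that by linarith
  then have S: "S \<subseteq> verts (middle_graph ?C)"
    by (auto simp: S_def middle_graph_def edgesC)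
  have "\<exists>j<?k. e i \<inter> e (3 * j) \<noteq> {}" if i: "i < n" for i
  proof -
    \<comment> \<open>Residue 0: \<open>e i\<close> is itself chosen. Residue 1: it shares
      \<open>i\<close> with the chosen edge before it. Residue 2: it shares its second endpoint with
      the chosen edge after it.\<close>
    consider "i mod 3 = 0" | "i mod 3 = 1" | "i mod 3 = 2" by linarith
    then show ?thesis
    proof cases
      case 1
      then have "i = 3 * (i div 3)"
        by presburger
      moreover from this have "i div 3 < ?k"
        using i by linarith
      ultimately show ?thesis
        by (metis e_def insert_not_empty inf.idem)
    next
      case 2
      then have j: "i = Suc (3 * (i div 3))"
        by presburger
      then have k: "i div 3 < ?k"
        using i by linarith
      have "i \<in> e i \<inter> e (3 * (i div 3))"
        using i j by (metis IntI e_def insertCI mod_less)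
      then show ?thesis using k by blast
    next
      case 3
      show ?thesis
      \<comment> \<open>For the last edge the second endpoint wraps to 0, so the chosen edge after
        it is \<open>e 0\<close>.\<close>
      proof (cases "Suc i = n")
        case True
        then have "0 \<in> e i \<inter> e (3 * 0)" by (simp add: e_def)
        moreover have "0 < ?k" using i by simp
        ultimately show ?thesis by blast
      next
        case False
        have j: "Suc i = 3 * (Suc i div 3)"
          using 3 by presburger
        then have k: "Suc i div 3 < ?k"
          using i False by linarith
        have "Suc i \<in> e i \<inter> e (3 * (Suc i div 3))"
          using i j False by (metis IntI Suc_lessI e_def insertCI mod_less)
        then show ?thesis using k by blast
      qed
    qed
  qed
  then have "edges ?C \<subseteq> (\<Union>x\<in>S. dominated_edges ?C x)"
    by (auto simp: S_def dominated_edges_def edgesC Bex_def)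
  with S have "isolating_set (middle_graph ?C) S"
    by (simp add: iff)
  moreover have "card S \<le> ?k"
    unfolding S_def by (metis card_image_le card_lessThan finite_lessThan)
  moreover have "?k \<le> card T" if "finite T" "isolating_set (middle_graph ?C) T" for T
  proof -
    have T: "T \<subseteq> verts (middle_graph ?C)" "edges ?C \<subseteq> (\<Union>x\<in>T. dominated_edges ?C x)"
      using that by (auto simp: iff)
    have fin: "finite (dominated_edges ?C x)" for x
      by (simp add: dominated_edges_def edgesC)
    have "n = card (edges ?C)"
      using card_edges_cycle_graph[OF assms] by simp
    also have "\<dots> \<le> card (\<Union>x\<in>T. dominated_edges ?C x)"
      using T that fin by (intro card_mono) auto
    also have "\<dots> \<le> (\<Sum>x\<in>T. card (dominated_edges ?C x))"
      using that by (intro card_UN_le)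
    also have "\<dots> \<le> (\<Sum>x\<in>T. 3)"
      using T by (intro sum_mono card_dominated_edges_cycle_graph) blast
    \<comment> \<open>As \<open>card T\<close> is an integer, it is at least \<open>n / 3\<close>
      rounded up, which is \<open>?k\<close>.\<close>
    finally have "n \<le> 3 * card T" by simp
    then show ?thesis by linarith
  qed
  ultimately show ?thesis
    by (intro isolation_number_eqI) (auto simp: S_def)
qed

end
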